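(* Let $\vartheta\in\mathbb{N}\setminus\{1\}$. Each of the sequences $(p_n^{(1,2)})_{n\ge1}$, $(q_n^{(1,2)})_{n\ge1}$ and $(r_n^{(1,2)})_{n\ge1}$ defined in the context satisfies the second order recurrence relation $$\alpha_n y_{n+2}+\beta_n y_{n+1}+\gamma_n y_n=0,\qquad n=1,2,\ldots,$$ where $$\alpha_n=(n+2)^3\left(24\vartheta^2n^3+30\vartheta^2n^2+16\vartheta^2n+3\vartheta^2+9\vartheta n^2+5\vartheta n+\vartheta-12n^3-21n^2-11n-2\right),$$ $$\begin{aligned}\beta_n=-2\big(&408\vartheta^2n^6+2346\vartheta^2n^5+5336\vartheta^2n^4+6130\vartheta^2n^3+3810\vartheta^2n^2+1268\vartheta^2n+172\vartheta^2\\&+153\vartheta n^5+769\vartheta n^4+1417\vartheta n^3+1143\vartheta n^2+382\vartheta n+52\vartheta\\&-204n^6-1275n^5-3181n^4-4011n^3-2667n^2-886n-120\big),\end{aligned}$$ $$\gamma_n=n^3\left(24\vartheta^2n^3+102\vartheta^2n^2+148\vartheta^2n+73\vartheta^2+9\vartheta n^2+23\vartheta n+15\vartheta-12n^3-57n^2-89n-46\right).$$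
   Context: $\mathbb{N}$ is the set of positive integers, $\zeta(s)=\sum_{m\ge1}m^{-s}$, $(\nu)_0=1$ and $(\nu)_n=\nu(\nu+1)\cdots(\nu+n-1)$ is the Pochhammer symbol, and $H_k^{(r)}=\sum_{l=1}^k l^{-r}$. For $n\ge1$ and the parameter $\vartheta$, define the rational function of $t$ $$R_{1,n}^{(1,2)}(t)=\frac{(-t)_n^2}{(t+1)_{n+1}^2}\cdot\frac{t+\vartheta n+1}{t-n+1}$$ (removable singularity at $t=n-1$ removed), with partial fraction expansion $$R_{1,n}^{(1,2)}(t)=\sum_{k=0}^{n}\frac{a_{k,n}^{(1,2)}}{t+k+1}-\sum_{k=0}^{n}\frac{b_{k,n}^{(1,2)}}{(t+k+1)^2}.$$ Put $$q_n^{(1,2)}=2\sum_{k=0}^{n}b_{k,n}^{(1,2)},\qquad p_n^{(1,2)}=2\sum_{k=1}^{n}b_{k,n}^{(1,2)}H_k^{(3)}-\sum_{k=1}^{n}a_{k,n}^{(1,2)}H_k^{(2)},\qquad r_n^{(1,2)}=q_n^{(1,2)}\zeta(3)-p_n^{(1,2)}.$$ *)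

theory Defs
  imports "HOL-Analysis.Analysis"
begin

definition zeta_real :: "nat \<Rightarrow> real"
  where "zeta_real s = (\<Sum>m. 1 / real (Suc m) ^ s)"

definition gen_harm :: "nat \<Rightarrow> nat \<Rightarrow> real"
  where "gen_harm r k = (\<Sum>l=1..k. 1 / real l ^ r)"

text \<open>
  At \<open>t = n - 1\<close> (with \<open>n \<ge> 1\<close>) the squared Pochhammer symbol in the numerator has a double zero,
  so the singularity of the second factor is removable and the continuous extension takes the
  value 0 there.  The convention \<open>x / 0 = 0\<close> yields this value, so no case distinction is needed.
\<close>

definition R12 :: "nat \<Rightarrow> nat \<Rightarrow> real \<Rightarrow> real"
  where "R12 \<theta> n t =
    (pochhammer (- t) n)\<^sup>2 / (pochhammer (t + 1) (n + 1))\<^sup>2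
      * ((t + real \<theta> * real n + 1) / (t - real n + 1))"

definition is_partial_fraction12 :: "nat \<Rightarrow> nat \<Rightarrow> (nat \<Rightarrow> real) \<Rightarrow> (nat \<Rightarrow> real) \<Rightarrow> bool"
  where "is_partial_fraction12 \<theta> n a b \<longleftrightarrow>
    (\<forall>t. (\<forall>k\<le>n. t \<noteq> - (real k + 1)) \<longrightarrow>
      R12 \<theta> n t = (\<Sum>k=0..n. a k / (t + real k + 1)) - (\<Sum>k=0..n. b k / (t + real k + 1)\<^sup>2))"

text \<open>
  For \<open>n \<ge> 1\<close> the function is proper (numerator of degree \<open>2 n\<close>, denominator of degree
  \<open>2 n + 2\<close>), so the expansion exists and its coefficients are unique at the indices \<open>k \<le> n\<close>;
  only these indices are used below.
\<close>

definition partial_fraction12 :: "nat \<Rightarrow> nat \<Rightarrow> (nat \<Rightarrow> real) \<times> (nat \<Rightarrow> real)"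
  where "partial_fraction12 \<theta> n = (SOME (a, b). is_partial_fraction12 \<theta> n a b)"

definition a12 :: "nat \<Rightarrow> nat \<Rightarrow> nat \<Rightarrow> real"
  where "a12 \<theta> n k = fst (partial_fraction12 \<theta> n) k"

definition b12 :: "nat \<Rightarrow> nat \<Rightarrow> nat \<Rightarrow> real"
  where "b12 \<theta> n k = snd (partial_fraction12 \<theta> n) k"

definition q12 :: "nat \<Rightarrow> nat \<Rightarrow> real"
  where "q12 \<theta> n = 2 * (\<Sum>k=0..n. b12 \<theta> n k)"

definition p12 :: "nat \<Rightarrow> nat \<Rightarrow> real"
  where "p12 \<theta> n =
    2 * (\<Sum>k=1..n. b12 \<theta> n k * gen_harm 3 k) - (\<Sum>k=1..n. a12 \<theta> n k * gen_harm 2 k)"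

definition r12 :: "nat \<Rightarrow> nat \<Rightarrow> real"
  where "r12 \<theta> n = q12 \<theta> n * zeta_real 3 - p12 \<theta> n"

definition alpha12 :: "real \<Rightarrow> real \<Rightarrow> real"
  where "alpha12 \<theta> n = (n + 2)^3 *
    (24 * \<theta>^2 * n^3 + 30 * \<theta>^2 * n^2 + 16 * \<theta>^2 * n + 3 * \<theta>^2
      + 9 * \<theta> * n^2 + 5 * \<theta> * n + \<theta>
      - 12 * n^3 - 21 * n^2 - 11 * n - 2)"

definition beta12 :: "real \<Rightarrow> real \<Rightarrow> real"
  where "beta12 \<theta> n = - 2 *
    (408 * \<theta>^2 * n^6 + 2346 * \<theta>^2 * n^5 + 5336 * \<theta>^2 * n^4 + 6130 * \<theta>^2 * n^3
      + 3810 * \<theta>^2 * n^2 + 1268 * \<theta>^2 * n + 172 * \<theta>^2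
      + 153 * \<theta> * n^5 + 769 * \<theta> * n^4 + 1417 * \<theta> * n^3 + 1143 * \<theta> * n^2
      + 382 * \<theta> * n + 52 * \<theta>
      - 204 * n^6 - 1275 * n^5 - 3181 * n^4 - 4011 * n^3 - 2667 * n^2 - 886 * n - 120)"

definition gamma12 :: "real \<Rightarrow> real \<Rightarrow> real"
  where "gamma12 \<theta> n = n^3 *
    (24 * \<theta>^2 * n^3 + 102 * \<theta>^2 * n^2 + 148 * \<theta>^2 * n + 73 * \<theta>^2
      + 9 * \<theta> * n^2 + 23 * \<theta> * n + 15 * \<theta>
      - 12 * n^3 - 57 * n^2 - 89 * n - 46)"

definition satisfies_recurrence12 :: "nat \<Rightarrow> (nat \<Rightarrow> real) \<Rightarrow> bool"
  where "satisfies_recurrence12 \<theta> y \<longleftrightarrow>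
    (\<forall>n\<ge>1. alpha12 (real \<theta>) (real n) * y (n + 2)
           + beta12 (real \<theta>) (real n) * y (n + 1)
           + gamma12 (real \<theta>) (real n) * y n = 0)"

end

theory Submission
  imports Defs "HOL-Computational_Algebra.Polynomial"
begin

text \<open>
  The proof is by creative telescoping. There is a rational function \<open>S\<close> of \<open>t\<close>
  (\<open>antidifference12\<close>) such that, for a factor \<open>(n + 1)\<^sup>2\<close> coming from its denominators,
  \<open>(n + 1)\<^sup>2 * (alpha12 \<theta> n * R12 \<theta> (n + 2) t + beta12 \<theta> n * R12 \<theta> (n + 1) t + gamma12 \<theta> n * R12 \<theta> n t)
  = S (t + 1) - S t\<close>. Once \<open>S\<close> is known, this (\<open>R12_telescopes\<close>) reduces to the polynomial identity
  \<open>certificate_identity\<close>.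

  The function \<open>S\<close> has at most double poles, at \<open>-1, ..., - (n + 2)\<close>, and a finite value at infinity.
  Let \<open>c k\<close> and \<open>- d k\<close> be its coefficients at \<open>1 / (t + k + 1)\<close> and \<open>1 / (t + k + 1)\<^sup>2\<close>. Partial
  fraction expansions are unique, so the same linear combinations of the numbers \<open>a12\<close> and \<open>b12\<close> are
  the differences \<open>c (k - 1) - c k\<close> and \<open>d (k - 1) - d k\<close>. For \<open>q12\<close>, twice the sum of the second ones
  is needed, and this telescopes to \<open>0\<close>. For \<open>p12\<close>, summation by parts against the harmonic numbers
  gives \<open>\<Sum>k. 2 * d k / (k + 1)^3 - c k / (k + 1)^2\<close>, which is the derivative of \<open>S\<close> at \<open>0\<close>
  (\<open>telescoping_annihilates\<close>). It vanishes since \<open>S\<close> contains the factor \<open>(pochhammer (- t) n)\<^sup>2\<close> with a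
  double zero at \<open>0\<close> (\<open>antidifference12_flat\<close>). Finally \<open>r12\<close> is a linear combination of \<open>q12\<close> and
  \<open>p12\<close> whose coefficients do not depend on \<open>n\<close>.
\<close>

section \<open>Partial fractions with double poles\<close>

text \<open>
  The poles are split off one at a time. At the last node \<open>x M\<close> the constants \<open>b\<close> and \<open>a\<close> are chosen
  so that \<open>P + b D - a (t - x M) D\<close>, with \<open>D\<close> the remaining denominator, has a double zero there; the
  quotient by \<open>(t - x M)\<^sup>2\<close> is the numerator for the remaining nodes. The zero polynomial is listed
  separately because its degree is \<open>0\<close>, which is not below \<open>2 * M\<close> when no node is left.
\<close>

lemma double_pole_expansion_exists:
  fixes P :: "'a::field poly" and x :: "nat \<Rightarrow> 'a"
  assumes "inj_on x {..<M}" and "P = 0 \<or> degree P < 2 * M"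
  shows "\<exists>a b. \<forall>t. (\<forall>k<M. t \<noteq> x k) \<longrightarrow>
    poly P t / (\<Prod>k<M. t - x k)\<^sup>2 = (\<Sum>k<M. a k / (t - x k) - b k / (t - x k)\<^sup>2)"
  using assms
proof (induction M arbitrary: P)
  case 0
  then show ?case by simp
next
  case (Suc M)
  define D where "D = (\<Prod>k<M. [:- x k, 1:])\<^sup>2"
  define X where "X = [:- x M, 1:]"
  define c where "c = poly D (x M)"
  have poly_D: "poly D t = (\<Prod>k<M. t - x k)\<^sup>2" for t
    by (simp add: D_def poly_prod)
  have "c \<noteq> 0"
    using Suc.prems(1) by (force simp: c_def poly_D inj_on_def)
  have "D \<noteq> 0" 
    using \<open>c \<noteq> 0\<close> by (auto simp: c_def)
  have deg_D: "degree D = 2 * M"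
    by (simp add: D_def degree_power_eq degree_prod_eq_sum_degree)
  define b where "b = - poly P (x M) / c"
  have "poly (P + smult b D) (x M) = 0"
    using \<open>c \<noteq> 0\<close> by (simp add: b_def flip: c_def)
  then obtain P2 where P2: "P + smult b D = X * P2"
    unfolding X_def by (metis poly_eq_0_iff_dvd dvdE)
  define a where "a = poly P2 (x M) / c"
  have "poly (P2 - smult a D) (x M) = 0"
    using \<open>c \<noteq> 0\<close> by (simp add: a_def flip: c_def)
  then obtain P3 where P3: "P2 - smult a D = X * P3"
    unfolding X_def by (metis poly_eq_0_iff_dvd dvdE)
  have P3': "X\<^sup>2 * P3 = P + smult b D - smult a (X * D)"
    unfolding P2 power2_eq_square mult.assoc P3[symmetric] by (simp add: algebra_simps)
  have deg_X: "degree X = 1" "X \<noteq> 0" by (auto simp: X_def)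
  have "degree (X * D) = 2 * M + 1"
    using deg_X \<open>D \<noteq> 0\<close> by (simp add: degree_mult_eq deg_D)
  moreover have "degree P \<le> 2 * M + 1" 
    using Suc.prems(2) by auto
  ultimately have "degree (X\<^sup>2 * P3) \<le> 2 * M + 1"
    unfolding P3'
    by (intro degree_diff_le degree_add_le order.trans[OF degree_smult_le]) (simp_all add: deg_D)
  then have "P3 = 0 \<or> degree P3 < 2 * M"
    using deg_X by (cases "P3 = 0") (simp_all add: degree_mult_eq degree_power_eq)
  moreover have "inj_on x {..<M}"
    using Suc.prems(1) by (rule inj_on_subset) auto
  ultimately obtain a' b' where IH: "\<And>t. (\<forall>k<M. t \<noteq> x k) \<Longrightarrow>
      poly P3 t / (\<Prod>k<M. t - x k)\<^sup>2 = (\<Sum>k<M. a' k / (t - x k) - b' k / (t - x k)\<^sup>2)"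
    using Suc.IH by blast
  show ?case
  proof (intro exI allI impI)
    fix t assume t: "\<forall>k<Suc M. t \<noteq> x k"
    define E where "E = (\<Prod>k<M. t - x k)\<^sup>2"
    have "E \<noteq> 0" using t by (simp add: E_def)
    have "t - x M \<noteq> 0" using t by simp
    have "(t - x M)\<^sup>2 * poly P3 t = poly P t + b * E - a * ((t - x M) * E)"
    proof -
      have "poly X t = t - x M" "poly D t = E"
        by (simp_all add: X_def E_def poly_D)
      then show ?thesis
        using arg_cong[OF P3', of "\<lambda>p. poly p t"] by simp
    qed
    then have P: "poly P t = (t - x M)\<^sup>2 * poly P3 t - b * E + a * ((t - x M) * E)"
      by (simp add: algebra_simps)
    have "(\<Prod>k<Suc M. t - x k)\<^sup>2 = (t - x M)\<^sup>2 * E"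
      by (simp add: E_def power_mult_distrib mult.commute)
    then have "poly P t / (\<Prod>k<Suc M. t - x k)\<^sup>2
        = poly P3 t / E + (a / (t - x M) - b / (t - x M)\<^sup>2)"
      using \<open>E \<noteq> 0\<close> \<open>t - x M \<noteq> 0\<close>
      by (simp add: P divide_simps power2_eq_square) (simp add: algebra_simps)
    also have "poly P3 t / E = (\<Sum>k<M. a' k / (t - x k) - b' k / (t - x k)\<^sup>2)"
      unfolding E_def using t by (intro IH) simp
    finally show "poly P t / (\<Prod>k<Suc M. t - x k)\<^sup>2
        = (\<Sum>k<Suc M. (a'(M := a)) k / (t - x k) - (b'(M := b)) k / (t - x k)\<^sup>2)"
      by simp
  qed
qed

text \<open>
  Multiplying by \<open>(t - x j)\<^sup>2\<close> and letting \<open>t\<close> tend to \<open>x j\<close> isolates \<open>- b j\<close>; once this vanishes,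
  the factor \<open>t - x j\<close> isolates \<open>a j\<close> in the same way.
\<close>

lemma double_pole_expansion_unique:
  fixes x a b :: "nat \<Rightarrow> real"
  assumes inj: "inj_on x {..<M}"
    and zero: "\<And>t. (\<forall>k<M. t \<noteq> x k) \<Longrightarrow>
      (\<Sum>k<M. a k / (t - x k) - b k / (t - x k)\<^sup>2) = 0"
    and j: "j < M"
  shows "a j = 0" and "b j = 0"
proof -
  define rest where "rest t = (\<Sum>k\<in>{..<M} - {j}. a k / (t - x k) - b k / (t - x k)\<^sup>2)" for t
  have "\<forall>\<^sub>F t in at (x j). \<forall>k\<in>{..<M}. t \<noteq> x k"
    by (intro eventually_ball_finite ballI eventually_neq_at_within) simp
  then have sum_zero: "\<forall>\<^sub>F t in at (x j). t \<noteq> x j \<and> a j / (t - x j) - b j / (t - x j)\<^sup>2 + rest t = 0"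
  proof eventually_elim
    case (elim t)
    then show ?case
      using zero[of t] sum.remove[of "{..<M}" j "\<lambda>k. a k / (t - x k) - b k / (t - x k)\<^sup>2"] j
      by (simp add: rest_def)
  qed
  have "x k \<noteq> x j" if "k \<in> {..<M} - {j}" for k
    using inj j that by (auto simp: inj_on_def)
  then have cont: "isCont rest (x j)"
    unfolding rest_def by (intro continuous_intros) (simp_all, metis+)
  have "((\<lambda>t. - b j + (t - x j) * a j + (t - x j)\<^sup>2 * rest t) \<longlongrightarrow>
      - b j + (x j - x j) * a j + (x j - x j)\<^sup>2 * rest (x j)) (at (x j))"
    by (intro tendsto_intros cont[unfolded isCont_def])
  moreover have "\<forall>\<^sub>F t in at (x j). - b j + (t - x j) * a j + (t - x j)\<^sup>2 * rest t = 0"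
    using sum_zero
  proof eventually_elim
    case (elim t)
    define z where "z = t - x j"
    have "z \<noteq> 0" "z\<^sup>2 * (a j / z - b j / z\<^sup>2 + rest t) = 0"
      using elim by (simp_all add: z_def)
    then have "- b j + z * a j + z\<^sup>2 * rest t = 0"
      by (simp add: algebra_simps power2_eq_square)
    then show ?case by (simp add: z_def)
  qed
  ultimately have "((\<lambda>_. 0) \<longlongrightarrow> - b j) (at (x j))"
    by (auto elim: Lim_transform_eventually)
  then show b: "b j = 0"
    using tendsto_unique[OF at_neq_bot tendsto_const] by force
  have "((\<lambda>t. a j + (t - x j) * rest t) \<longlongrightarrow> a j + (x j - x j) * rest (x j)) (at (x j))"
    by (intro tendsto_intros cont[unfolded isCont_def])
  moreover have "\<forall>\<^sub>F t in at (x j). a j + (t - x j) * rest t = 0"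
    using sum_zero
  proof eventually_elim
    case (elim t)
    define z where "z = t - x j"
    have "z \<noteq> 0" "z * (a j / z + rest t) = 0"
      using elim b by (simp_all add: z_def)
    then have "a j + z * rest t = 0"
      by (simp add: algebra_simps)
    then show ?case by (simp add: z_def)
  qed
  ultimately have "((\<lambda>_. 0) \<longlongrightarrow> a j) (at (x j))"
    by (auto elim: Lim_transform_eventually)
  then show "a j = 0"
    using tendsto_unique[OF at_neq_bot tendsto_const] by force
qed

section \<open>Expansions at the negative integers\<close>

lemma pochhammer_eq_prod:
  fixes t :: "'a::idom"
  shows "pochhammer (- t) n = poly (\<Prod>i<n. [:of_nat i, - 1:]) t"
    and "pochhammer (t + 1) n = (\<Prod>k<n. t - - (of_nat k + 1))"
  by (simp_all add: pochhammer_prod poly_prod atLeast0LessThan algebra_simps)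

lemma degree_pochhammer_poly: "degree (\<Prod>i<n. [:of_nat i, - 1::'a::idom:]) = n"
  by (simp add: degree_prod_eq_sum_degree)

abbreviation double_poles :: "(nat \<Rightarrow> real) \<Rightarrow> (nat \<Rightarrow> real) \<Rightarrow> nat \<Rightarrow> real \<Rightarrow> real" where
  "double_poles a b M t \<equiv> \<Sum>k<M. a k / (t + real k + 1) - b k / (t + real k + 1)\<^sup>2"

text \<open>
  When numerator and denominator may have the same degree, the value at infinity, which is
  \<open>coeff P (2 * M)\<close> as the denominator is monic, has to be split off before the expansion into
  poles applies.
\<close>

lemma pochhammer_expansion_exists:
  fixes P :: "real poly"
  assumes "degree P \<le> 2 * M"
  shows "\<exists>a b. \<forall>t. (\<forall>k<M. t \<noteq> - (real k + 1)) \<longrightarrow>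
    poly P t / (pochhammer (t + 1) M)\<^sup>2 = coeff P (2 * M) + double_poles a b M t"
proof -
  define D where "D = (\<Prod>k<M. [:real k + 1, 1:])\<^sup>2"
  have poly_D: "poly D t = (pochhammer (t + 1) M)\<^sup>2" for t
    by (simp add: D_def poly_prod pochhammer_prod atLeast0LessThan add_ac)
  have deg_D: "degree D = 2 * M"
    by (simp add: D_def degree_power_eq degree_prod_eq_sum_degree)
  moreover have "lead_coeff D = 1"
    by (simp add: D_def lead_coeff_power lead_coeff_prod)
  ultimately have "coeff (P - smult (coeff P (2 * M)) D) (2 * M) = 0"
    by simp
  moreover have "degree (P - smult (coeff P (2 * M)) D) \<le> 2 * M"
    using assms deg_D by (intro degree_diff_le order.trans[OF degree_smult_le]) simp_all
  ultimately have proper: "P - smult (coeff P (2 * M)) D = 0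
      \<or> degree (P - smult (coeff P (2 * M)) D) < 2 * M"
    by (intro eq_zero_or_degree_less)
  have "inj_on (\<lambda>k. - (real k + 1)) {..<M}"
    by (simp add: inj_on_def)
  from double_pole_expansion_exists[OF this proper]
  obtain a b where ab: "\<forall>t. (\<forall>k<M. t \<noteq> - (real k + 1)) \<longrightarrow>
      poly (P - smult (coeff P (2 * M)) D) t / (\<Prod>k<M. t - - (real k + 1))\<^sup>2
      = (\<Sum>k<M. a k / (t - - (real k + 1)) - b k / (t - - (real k + 1))\<^sup>2)"
    by blast
  have "poly P t / (pochhammer (t + 1) M)\<^sup>2 = coeff P (2 * M) + double_poles a b M t"
    if t: "\<forall>k<M. t \<noteq> - (real k + 1)" for t
  proof -
    have "poly D t \<noteq> 0"
      unfolding poly_D pochhammer_eq_prod(2) using t by auto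
    moreover have "double_poles a b M t = (poly P t - coeff P (2 * M) * poly D t) / poly D t"
    proof -
      have minus: "t - - (real k + 1) = t + real k + 1" for k by simp
      have "poly (P - smult (coeff P (2 * M)) D) t / poly D t = double_poles a b M t"
        using ab[rule_format, OF t[rule_format]]
        unfolding poly_D pochhammer_eq_prod(2) minus by simp
      then show ?thesis by simp
    qed
    ultimately show ?thesis
      unfolding poly_D[symmetric] by (simp add: field_simps)
  qed
  then show ?thesis by blast
qed

text \<open>
  The factor \<open>t - real m\<close> of the denominator cancels against one of the two factors
  \<open>t - real m\<close> in the squared Pochhammer symbol. The result also covers \<open>t = real m\<close>, where both
  sides are \<open>0\<close>.
\<close>

lemma R12_Suc:
  "R12 \<theta> (Suc m) t = (pochhammer (- t) m)\<^sup>2 * (t - real m) * (t + real \<theta> * real (Suc m) + 1)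
     / (pochhammer (t + 1) (Suc (Suc m)))\<^sup>2"
proof (cases "t = real m")
  case True
  then show ?thesis by (simp add: R12_def pochhammer_Suc)
next
  case False
  define w x z D where "w = t - real m" and "x = pochhammer (- t) m"
    and "z = t + real \<theta> * real (Suc m) + 1" and "D = pochhammer (t + 1) (Suc (Suc m))"
  have "w \<noteq> 0" using False by (simp add: w_def)
  have "pochhammer (- t) (Suc m) = x * - w" "t - real (Suc m) + 1 = w"
    by (simp_all add: pochhammer_Suc x_def w_def)
  then have "R12 \<theta> (Suc m) t = (x * - w)\<^sup>2 / D\<^sup>2 * (z / w)"
    unfolding R12_def z_def D_def by simp
  also have "\<dots> = x\<^sup>2 * w * z / D\<^sup>2"
    using \<open>w \<noteq> 0\<close> by (simp add: power2_eq_square)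
  finally show ?thesis unfolding w_def x_def z_def D_def .
qed

lemma R12_expansion:
  assumes "n \<ge> 1" "\<forall>k\<le>n. t \<noteq> - (real k + 1)"
  shows "R12 \<theta> n t = double_poles (a12 \<theta> n) (b12 \<theta> n) (Suc n) t"
proof -
  obtain m where n: "n = Suc m" using assms(1) by (cases n) auto
  define W where "W = (\<Prod>i<m. [:real i, - 1:])"
  define L where "L = [:- real m, 1:] * [:real \<theta> * real n + 1, 1:]"
  define P where "P = W\<^sup>2 * L"
  have "degree W = m"
    unfolding W_def by (rule degree_pochhammer_poly)
  then have "degree (W\<^sup>2) \<le> 2 * m"
    using degree_power_le[of W 2] by simp
  moreover have "degree L \<le> 2"
    unfolding L_def by (rule order.trans[OF degree_mult_le]) simp
  ultimately have deg: "degree P < 2 * Suc n"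
    using degree_mult_le[of "W\<^sup>2" L] by (simp add: P_def n)
  then have "coeff P (2 * Suc n) = 0" by (intro coeff_eq_0)
  moreover have "R12 \<theta> n t = poly P t / (pochhammer (t + 1) (Suc n))\<^sup>2" for t
    by (simp add: n R12_Suc P_def L_def W_def pochhammer_eq_prod(1) mult.assoc) (simp add: algebra_simps)
  ultimately obtain a b where "\<forall>t. (\<forall>k<Suc n. t \<noteq> - (real k + 1)) \<longrightarrow>
      R12 \<theta> n t = double_poles a b (Suc n) t"
    using pochhammer_expansion_exists[of P "Suc n"] deg by auto
  then have "is_partial_fraction12 \<theta> n a b"
    unfolding is_partial_fraction12_def atLeast0AtMost lessThan_Suc_atMost
    by (simp add: sum_subtractf less_Suc_eq_le)
  then have "\<exists>ab. case ab of (a, b) \<Rightarrow> is_partial_fraction12 \<theta> n a b"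
    by auto
  then have "case partial_fraction12 \<theta> n of (a, b) \<Rightarrow> is_partial_fraction12 \<theta> n a b"
    unfolding partial_fraction12_def by (rule someI_ex)
  then have "is_partial_fraction12 \<theta> n (a12 \<theta> n) (b12 \<theta> n)"
    by (simp add: a12_def[abs_def] b12_def[abs_def] case_prod_unfold)
  then show ?thesis
    using assms(2) unfolding is_partial_fraction12_def atLeast0AtMost lessThan_Suc_atMost
    by (simp add: sum_subtractf)
qed

section \<open>Telescoping differences and weighted coefficient sums\<close>

text \<open>
  Summation by parts for a sequence \<open>d 0, ..., d (M - 1)\<close> continued by \<open>0\<close> on both sides.
\<close>

lemma sum_shift_difference:
  fixes d h :: "nat \<Rightarrow> 'a::comm_ring_1"
  shows "(\<Sum>k<Suc M. ((if k = 0 then 0 else d (k - 1)) - (if k < M then d k else 0)) * h k)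
    = (\<Sum>k<M. d k * (h (Suc k) - h k))"
proof -
  have "(\<Sum>k<Suc M. (if k = 0 then 0 else d (k - 1)) * h k) = (\<Sum>k<M. d k * h (Suc k))"
    by (subst sum.lessThan_Suc_shift) simp
  moreover have "(\<Sum>k<Suc M. (if k < M then d k else 0) * h k) = (\<Sum>k<M. d k * h k)"
    by simp
  ultimately show ?thesis
    by (simp only: left_diff_distrib right_diff_distrib sum_subtractf)
qed

lemma gen_harm_Suc: "gen_harm r (Suc k) = gen_harm r k + 1 / (real k + 1) ^ r"
  by (simp add: gen_harm_def add.commute)

lemma has_derivative_double_pole:
  fixes c d K :: real
  assumes "K \<noteq> 0"
  shows "((\<lambda>t. c / (t + K) - d / (t + K)\<^sup>2) has_field_derivative 2 * d / K ^ 3 - c / K ^ 2) (at 0)"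
  using assms
  by (auto intro!: derivative_eq_intros simp: power2_eq_square power3_eq_cube mult_ac)

text \<open>
  If \<open>A\<close> and \<open>B\<close> are the coefficients of \<open>S (t + 1) - S t\<close>, uniqueness of the expansion gives
  \<open>A k = c (k - 1) - c k\<close> and \<open>B k = d (k - 1) - d k\<close>, where missing coefficients are \<open>0\<close>. So the
  sum of all \<open>B k\<close> telescopes to \<open>0\<close>. Summation by parts turns the sums weighted by harmonic numbers
  into \<open>\<Sum>k<M. 2 * d k / (k + 1)^3 - c k / (k + 1)^2\<close>, which is the derivative of \<open>S\<close> at \<open>0\<close>. The
  constant \<open>C\<close> cancels in the difference.
\<close>

lemma telescoping_annihilates:
  fixes A B c d :: "nat \<Rightarrow> real" and S :: "real \<Rightarrow> real"
  assumes S: "\<And>t. (\<forall>k<M. t \<noteq> - (real k + 1)) \<Longrightarrow> S t = C + double_poles c d M t"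
    and telescope: "\<And>t. (\<forall>k<Suc M. t \<noteq> - (real k + 1)) \<Longrightarrow>
      double_poles A B (Suc M) t = S (t + 1) - S t"
    and flat: "(S has_field_derivative 0) (at 0)"
  shows "(\<Sum>k<Suc M. B k) = 0"
    and "2 * (\<Sum>k<Suc M. B k * gen_harm 3 k) - (\<Sum>k<Suc M. A k * gen_harm 2 k) = 0"
proof -
  define shift where "shift f k = (if k = 0 then 0 else f (k - 1)) - (if k < M then f k else 0)"
    for f :: "nat \<Rightarrow> real" and k
  have coeffs: "A j = shift c j \<and> B j = shift d j" if "j < Suc M" for j
  proof -
    have "(\<Sum>k<Suc M. (A k - shift c k) / (t - - (real k + 1))
        - (B k - shift d k) / (t - - (real k + 1))\<^sup>2) = 0"
      if t: "\<forall>k<Suc M. t \<noteq> - (real k + 1)" for t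
    proof -
      have "t + 1 \<noteq> - (real k + 1)" if "k < M" for k
        using t[rule_format, of "Suc k"] that by auto
      then have "S (t + 1) = C + double_poles c d M (t + 1)"
        by (intro S) auto
      also have "double_poles c d M (t + 1) = 
          (\<Sum>k<M. c k * (1 / (t + real (Suc k) + 1)) - d k * (1 / (t + real (Suc k) + 1)\<^sup>2))"
        by (simp add: add_ac)
      finally have "S (t + 1) - S t = 
          (\<Sum>k<M. c k * (1 / (t + real (Suc k) + 1) - 1 / (t + real k + 1)))
          - (\<Sum>k<M. d k * (1 / (t + real (Suc k) + 1)\<^sup>2 - 1 / (t + real k + 1)\<^sup>2))"
        using t by (simp add: S sum_subtractf right_diff_distrib)
      also have "\<dots> = double_poles (shift c) (shift d) (Suc M) t"
        using sum_shift_difference[of c M "\<lambda>k. 1 / (t + real k + 1)"]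
          sum_shift_difference[of d M "\<lambda>k. 1 / (t + real k + 1)\<^sup>2"]
        unfolding sum_subtractf shift_def by simp
      finally have "double_poles A B (Suc M) t - double_poles (shift c) (shift d) (Suc M) t = 0"
        using telescope[OF t] by simp
      then show ?thesis
        unfolding sum_subtractf[symmetric] by (simp add: diff_divide_distrib algebra_simps)
    qed
    note zero = double_pole_expansion_unique[of "\<lambda>k. - (real k + 1)", OF _ this \<open>j < Suc M\<close>]
    show ?thesis
      using zero by (simp add: inj_on_def)
  qed
  have transfer: "(\<Sum>k<Suc M. B k * h k) = (\<Sum>k<M. d k * (h (Suc k) - h k))"
    "(\<Sum>k<Suc M. A k * h k) = (\<Sum>k<M. c k * (h (Suc k) - h k))" for h
    using sum_shift_difference[of d M h] sum_shift_difference[of c M h] coeffs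
    unfolding shift_def by simp_all
  show "(\<Sum>k<Suc M. B k) = 0"
    using transfer(1)[of "\<lambda>_. 1"] by simp
  have "((\<lambda>t. C + double_poles c d M t) has_field_derivative
      (\<Sum>k<M. 2 * d k / (real k + 1) ^ 3 - c k / (real k + 1) ^ 2)) (at 0)"
  proof -
    have "((\<lambda>t. c k / (t + real k + 1) - d k / (t + real k + 1)\<^sup>2) has_field_derivative
        2 * d k / (real k + 1) ^ 3 - c k / (real k + 1) ^ 2) (at 0)" for k
      using has_derivative_double_pole[of "real k + 1" "c k" "d k"] by (simp add: add.assoc)
    then show ?thesis
      by (intro DERIV_cong[OF DERIV_add[OF DERIV_const DERIV_sum]]) auto
  qed
  moreover have "((\<lambda>t. C + double_poles c d M t) has_field_derivative 0) (at 0)"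
  proof (rule has_field_derivative_transform_within_open[OF flat, of "{-1<..}"])
    fix t :: real assume "t \<in> {-1<..}"
    then show "S t = C + double_poles c d M t"
      by (intro S) auto
  qed auto
  ultimately have "(\<Sum>k<M. 2 * d k / (real k + 1) ^ 3 - c k / (real k + 1) ^ 2) = 0"
    by (rule DERIV_unique)
  then show "2 * (\<Sum>k<Suc M. B k * gen_harm 3 k) - (\<Sum>k<Suc M. A k * gen_harm 2 k) = 0"
    unfolding transfer gen_harm_Suc by (simp add: sum_subtractf sum_distrib_left)
qed

section \<open>The telescoping certificate\<close>

text \<open>
  These coefficients solve a linear system. The combination
  \<open>alpha12 \<theta> n * R12 \<theta> (n + 2) t + beta12 \<theta> n * R12 \<theta> (n + 1) t + gamma12 \<theta> n * R12 \<theta> n t\<close> should be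
  \<open>T (t + 1) - T t\<close>. The double poles and double zeros of its terms suggest
  \<open>T t = (pochhammer (- t) n)\<^sup>2 * s t / (pochhammer (t + 1) (n + 2))\<^sup>2\<close> with a polynomial \<open>s\<close>. Clearing
  denominators turns this into an equation between polynomials in \<open>t\<close>; comparing leading coefficients
  leaves only degree at most \<open>4\<close> for \<open>s\<close>, and the value at \<open>t = n - 1\<close> forces \<open>s n = 0\<close>.
  The cubic \<open>s t / (t - n)\<close> is then determined, and it is recorded here multiplied by
  \<open>(n + 1)\<^sup>2 / 2\<close>, which clears its denominators, and written in the variables \<open>N = n + 1\<close> and
  \<open>x = t + 1\<close>, in which it has fewer terms than in \<open>n\<close> and \<open>t\<close>.
\<close>

definition cert :: "real \<Rightarrow> real \<Rightarrow> real poly" where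
  "cert \<theta> N = [:
     N^3 * (\<theta> * (- 192 * N^6 - 48 * N^5 + 124 * N^4 + 44 * N^3 - 27 * N^2 - 12 * N - 1)
       + \<theta>^2 * (144 * N^5 + 8 * N^4 - 132 * N^3 - 18 * N^2 + 36 * N + 10)
       + \<theta>^3 * (384 * N^6 - 96 * N^5 - 260 * N^4 + 88 * N^3 + 81 * N^2 - 24 * N - 13)),
     N^2 * (- 192 * N^6 - 48 * N^5 + 118 * N^4 + 41 * N^3 - 24 * N^2 - 11 * N
       + \<theta> * (96 * N^5 - 4 * N^4 - 76 * N^3 - 19 * N^2 + 24 * N + 9)
       + \<theta>^2 * (384 * N^6 - 96 * N^5 - 194 * N^4 + 41 * N^3 + 66 * N^2 - 11 * N - 14)
       + \<theta>^3 * (96 * N^5 - 48 * N^4 - 34 * N^3 + 13 * N^2 + 2 * N + 1)),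
     N * (- 12 * N^4 - 8 * N^3 + 7 * N^2 + 3 * N
       + \<theta> * (96 * N^6 - 24 * N^5 - 92 * N^4 + 26 * N^3 + 31 * N^2 - 6 * N - 4)
       + \<theta>^2 * (- 72 * N^5 + 68 * N^4 + 54 * N^3 - 35 * N^2 - 13 * N + 2)
       + \<theta>^3 * (- 192 * N^6 + 144 * N^5 + 124 * N^4 - 100 * N^3 - 35 * N^2 + 20 * N + 6)),
     96 * N^6 - 24 * N^5 - 50 * N^4 - 3 * N^3 + 11 * N^2 + 4 * N
       + \<theta> * (- 24 * N^5 - 4 * N^4 + 22 * N^3 + 11 * N^2 - 8 * N - 4)
       + \<theta>^2 * (- 192 * N^6 + 144 * N^5 + 22 * N^4 - 21 * N^3 - 3 * N^2 - 4 * N + 2)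
       + \<theta>^3 * (- 96 * N^5 + 120 * N^4 + 2 * N^3 - 51 * N^2 + 8 * N + 6):]"

text \<open>
  This is \<open>(n + 1)\<^sup>2\<close> times the telescoping equation, after division by everything that the three
  rational functions and the two values of the antidifference have in common. What remains is an identity between
  polynomials in three variables, which holds by expansion.
\<close>

lemma certificate_identity:
  fixes \<theta> n t :: real
  shows "(n + 1)^2 *
     (alpha12 \<theta> n * ((t - n + 1) * (t - n)^2 * (t - n - 1) * (t + \<theta> * (n + 2) + 1))
      + beta12 \<theta> n * ((t - n + 1) * (t - n) * (t + \<theta> * (n + 1) + 1) * (t + n + 3)^2)
      + gamma12 \<theta> n * ((t + \<theta> * n + 1) * ((t + n + 2) * (t + n + 3))^2))
   = 2 * ((t + 1)^4 * poly (cert \<theta> (n + 1)) (t + 2))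
     - 2 * ((t - n) * (t - n + 1) * (t + n + 3)^2 * poly (cert \<theta> (n + 1)) (t + 1))"
proof -
  \<comment> \<open>Rewriting in the shifted variables of the certificate keeps the expanded polynomials small.\<close>
  define N x where "N = n + 1" and "x = t + 1"
  have [simp]: "n = N - 1" "t = x - 1" by (simp_all add: N_def x_def)
  show ?thesis
    by (simp add: alpha12_def beta12_def gamma12_def cert_def del: power_Suc) algebra
qed

definition antidifference12 :: "nat \<Rightarrow> nat \<Rightarrow> real \<Rightarrow> real" where
  "antidifference12 \<theta> n t = 2 * (pochhammer (- t) n)\<^sup>2 * (t - real n)
     * poly (cert (real \<theta>) (real n + 1)) (t + 1) / (pochhammer (t + 1) (n + 2))\<^sup>2"

text \<open>
  All five functions involved are polynomial multiples of
  \<open>(pochhammer (- t) (n - 1))\<^sup>2 * (t - n + 1) / (pochhammer (t + 1) (n + 3))\<^sup>2\<close>; the cofactors are those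
  of \<open>certificate_identity\<close>.
\<close>

lemma R12_telescopes:
  assumes "n \<ge> 1" and t: "\<forall>k<n + 3. t \<noteq> - (real k + 1)"
  shows "(real n + 1)\<^sup>2 *
     (alpha12 \<theta> n * R12 \<theta> (n + 2) t + beta12 \<theta> n * R12 \<theta> (n + 1) t + gamma12 \<theta> n * R12 \<theta> n t)
   = antidifference12 \<theta> n (t + 1) - antidifference12 \<theta> n t"
proof -
  obtain m where n: "n = Suc m" using assms(1) by (cases n) auto
  define x where "x = pochhammer (- t) m"
  define y where "y = pochhammer (t + 1) (n + 3)"
  define D where "D = pochhammer (t + 1) (Suc n)"
  define u where "u = t - n + 1"
  define v w where "v = t + n + 2" and "w = t + n + 3"
  have m: "t - real m = u" by (simp add: n u_def)
  have [simp]: "v \<noteq> 0" "w \<noteq> 0"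
    using t[rule_format, of "n + 1"] t[rule_format, of "n + 2"] by (auto simp: v_def w_def)
  have [simp]: "t + 1 \<noteq> 0" using t[rule_format, of 0] by simp
  have [simp]: "y \<noteq> 0"
    unfolding y_def pochhammer_eq_prod(2) using t by auto
  have Dv: "pochhammer (t + 1) (Suc (Suc n)) = D * v"
    by (simp add: D_def v_def pochhammer_Suc[of _ "Suc n"] add_ac)
  have y3: "y = pochhammer (t + 1) (Suc (Suc (Suc n)))"
    by (simp add: y_def eval_nat_numeral)
  have yw: "y = D * v * w"
    unfolding y3 pochhammer_Suc[of _ "Suc (Suc n)"] Dv by (simp add: w_def add_ac)
  have yt: "y = (t + 1) * pochhammer (t + 1 + 1) (Suc (Suc n))"
    unfolding y3 by (rule pochhammer_rec)
  have [simp]: "D \<noteq> 0" using \<open>y \<noteq> 0\<close> yw by auto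
  have [simp]: "pochhammer (t + 1 + 1) (Suc (Suc n)) \<noteq> 0" using \<open>y \<noteq> 0\<close> yt by auto
  have pos: "pochhammer (- t) n = x * (- u)"
    by (simp add: n pochhammer_Suc x_def u_def)
  have pos': "pochhammer (- t) (Suc n) = x * (- u) * (n - t)"
    by (simp only: pochhammer_Suc pos) simp
  have pos1: "pochhammer (- (t + 1)) n = - (t + 1) * x"
    unfolding n pochhammer_rec by (simp add: x_def)
  have R0: "R12 \<theta> n t = x\<^sup>2 * u / y\<^sup>2 * ((t + real \<theta> * real n + 1) * (v * w)\<^sup>2)"
  proof -
    have "R12 \<theta> n t = x\<^sup>2 * u * (t + real \<theta> * real n + 1) / D\<^sup>2"
      using R12_Suc[of \<theta> m t] unfolding x_def D_def m n[symmetric] by simp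
    then show ?thesis
      by (simp add: yw power_mult_distrib)
  qed
  have R1: "R12 \<theta> (n + 1) t = x\<^sup>2 * u / y\<^sup>2 * (u * (t - n) * (t + real \<theta> * (real n + 1) + 1) * w\<^sup>2)"
  proof -
    define z where "z = t + real \<theta> * real (n + 1) + 1"
    have "R12 \<theta> (n + 1) t = (x * (- u))\<^sup>2 * (t - n) * z / (D * v)\<^sup>2"
      by (simp only: Suc_eq_plus1[symmetric] R12_Suc pos Dv z_def)
    also have "\<dots> = x\<^sup>2 * u / y\<^sup>2 * (u * (t - n) * z * w\<^sup>2)"
      unfolding yw by (simp add: power_mult_distrib) (simp add: power2_eq_square mult_ac)
    finally show ?thesis unfolding z_def of_nat_add of_nat_1 .
  qed
  have R2: "R12 \<theta> (n + 2) t
      = x\<^sup>2 * u / y\<^sup>2 * (u * (t - n)\<^sup>2 * (t - n - 1) * (t + real \<theta> * (real n + 2) + 1))"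
  proof -
    define z where "z = t + real \<theta> * real (n + 2) + 1"
    have "R12 \<theta> (n + 2) t = (x * (- u) * (n - t))\<^sup>2 * (t - real (Suc n)) * z / y\<^sup>2"
      by (simp only: add_2_eq_Suc' R12_Suc pos' y3 z_def)
    also have "(x * (- u) * (n - t))\<^sup>2 = x\<^sup>2 * u * (u * (t - n)\<^sup>2)"
      by (simp add: power2_eq_square algebra_simps)
    also have "t - real (Suc n) = t - n - 1" by simp
    finally have "R12 \<theta> (n + 2) t = x\<^sup>2 * u / y\<^sup>2 * (u * (t - n)\<^sup>2 * (t - n - 1) * z)"
      by (simp add: mult_ac)
    then show ?thesis unfolding z_def of_nat_add of_nat_numeral .
  qed
  have S0: "antidifference12 \<theta> n t
      = x\<^sup>2 * u / y\<^sup>2 * (2 * ((t - n) * u * w\<^sup>2 * poly (cert \<theta> (real n + 1)) (t + 1)))"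
  proof -
    define K where "K = poly (cert \<theta> (real n + 1)) (t + 1)"
    have "antidifference12 \<theta> n t = 2 * (x * (- u))\<^sup>2 * (t - n) * K / (D * v)\<^sup>2"
      by (simp only: antidifference12_def add_2_eq_Suc' pos Dv K_def)
    also have "\<dots> = x\<^sup>2 * u / y\<^sup>2 * (2 * ((t - n) * u * w\<^sup>2 * K))"
      unfolding yw by (simp add: power_mult_distrib) (simp add: power2_eq_square mult_ac)
    finally show ?thesis unfolding K_def .
  qed
  have S1: "antidifference12 \<theta> n (t + 1)
      = x\<^sup>2 * u / y\<^sup>2 * (2 * ((t + 1) ^ 4 * poly (cert \<theta> (real n + 1)) (t + 2)))"
  proof -
    define K where "K = poly (cert \<theta> (real n + 1)) (t + 2)"
    define s where "s = t + 1"
    have eqs: "t + 1 - real n = u" "t + 1 + 1 = t + 2" "pochhammer (t + 2) (Suc (Suc n)) = y / s"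
      "pochhammer (- (t + 1)) n = - s * x"
      using yt pos1 by (simp_all add: u_def s_def add.assoc)
    have "antidifference12 \<theta> n (t + 1) = 2 * (- s * x)\<^sup>2 * u * K / (y / s)\<^sup>2"
      by (simp only: antidifference12_def add_2_eq_Suc' eqs K_def)
    also have "\<dots> = x\<^sup>2 * u / y\<^sup>2 * (2 * (s ^ 4 * K))"
      by (simp add: power_mult_distrib power_divide eval_nat_numeral)
    finally show ?thesis unfolding K_def s_def .
  qed
  have factor: "c * (p * (k * e) + p' * (k * e') + p'' * (k * e''))
      = k * (c * (p * e + p' * e' + p'' * e''))" for c k p p' p'' e e' e'' :: real
    by (simp add: algebra_simps)
  show ?thesis
    unfolding R0 R1 R2 factor S0 S1 unfolding u_def v_def w_def certificate_identity
    by (rule right_diff_distrib)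
qed

text \<open>
  The numerator has degree at most \<open>2 * n + 1 + 3\<close>, exactly as much as the denominator.
\<close>

lemma antidifference12_expansion:
  "\<exists>C c d. \<forall>t. (\<forall>k<n + 2. t \<noteq> - (real k + 1)) \<longrightarrow>
     antidifference12 \<theta> n t = C + double_poles c d (n + 2) t"
proof -
  define W where "W = (\<Prod>i<n. [:real i, - 1:])"
  define Q where "Q = [:- real n, 1:] * (cert \<theta> (real n + 1) \<circ>\<^sub>p [:1, 1:])"
  define P where "P = smult 2 (W\<^sup>2 * Q)"
  have "degree W = n"
    unfolding W_def by (rule degree_pochhammer_poly)
  then have "degree (W\<^sup>2) \<le> 2 * n"
    using degree_power_le[of W 2] by simp
  moreover have "degree (cert \<theta> (real n + 1)) \<le> 3"
    unfolding cert_def by (rule degree_le) (simp add: coeff_pCons split: nat.split)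
  then have "degree Q \<le> 4"
    unfolding Q_def by (intro order.trans[OF degree_mult_le]) (simp add: degree_pcompose)
  moreover have "degree P \<le> degree (W\<^sup>2) + degree Q"
    unfolding P_def by (intro order.trans[OF degree_smult_le] degree_mult_le)
  ultimately have deg: "degree P \<le> 2 * (n + 2)" by simp
  have "poly Q t = (t - real n) * poly (cert \<theta> (real n + 1)) (t + 1)" for t
    by (simp add: Q_def poly_pcompose algebra_simps)
  then have "antidifference12 \<theta> n t = poly P t / (pochhammer (t + 1) (n + 2))\<^sup>2" for t
    by (simp add: antidifference12_def P_def W_def pochhammer_eq_prod(1) mult.assoc)
  then show ?thesis
    using pochhammer_expansion_exists[OF deg] by auto
qed

text \<open>
  For \<open>n \<ge> 1\<close> the square of \<open>pochhammer (- t) n\<close> contributes a double zero at \<open>0\<close>. This is the reason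
  why no inhomogeneous term appears in the recurrence for \<open>p12\<close>.
\<close>

lemma antidifference12_flat:
  assumes "n \<ge> 1"
  shows "(antidifference12 \<theta> n has_field_derivative 0) (at 0)"
proof -
  obtain m where n: "n = Suc m" using assms by (cases n) auto
  define U where "U = (\<Prod>i<m. [:real (Suc i), - 1:])"
  define V where "V = (\<Prod>k<n + 2. [:real k + 1, 1:])"
  define K where "K = cert (real \<theta>) (real n + 1) \<circ>\<^sub>p [:1, 1:]"
  define g where "g t = 2 * (poly U t)\<^sup>2 * (t - real n) * poly K t / (poly V t)\<^sup>2" for t
  have eq: "antidifference12 \<theta> n = (\<lambda>t. t\<^sup>2 * g t)"
  proof
    fix t
    have "pochhammer (- t) n = - t * poly U t"
      unfolding n pochhammer_rec U_def
      by (simp add: pochhammer_prod poly_prod atLeast0LessThan algebra_simps)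
    moreover have "pochhammer (t + 1) (n + 2) = poly V t"
      unfolding V_def pochhammer_prod poly_prod atLeast0LessThan
      by (intro prod.cong) simp_all
    moreover have "poly (cert (real \<theta>) (real n + 1)) (t + 1) = poly K t"
      by (simp add: K_def poly_pcompose add.commute)
    ultimately show "antidifference12 \<theta> n t = t\<^sup>2 * g t"
      unfolding antidifference12_def by (simp add: g_def power_mult_distrib)
  qed
  have "poly V 0 \<noteq> 0"
    unfolding V_def poly_prod by (simp add: prod_zero_iff del: prod.lessThan_Suc)
  then have "g differentiable (at 0)"
    unfolding g_def by (intro derivative_intros) simp_all
  then obtain D where "(g has_field_derivative D) (at 0)"
    by (auto simp: real_differentiable_def)
  moreover have "((\<lambda>t::real. t\<^sup>2) has_field_derivative 0) (at 0)"
    by (auto intro!: derivative_eq_intros)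
  ultimately show ?thesis
    using DERIV_mult[of "\<lambda>t. t\<^sup>2" 0 0 UNIV g D] by (simp add: eq)
qed

section \<open>The recurrences\<close>

text \<open>
  The numbers \<open>q12 \<theta> n\<close> and \<open>p12 \<theta> n\<close> are fixed linear functionals of the coefficients, and these
  coefficients enter linearly in the expansion. So the combination of the three consecutive values is
  the same functional applied to the coefficients of a telescoping difference. The coefficients of the
  three expansions are cut off outside their range, to be summed over the common range \<open>k < n + 3\<close>.
\<close>

lemma p12_q12_recurrence:
  fixes n :: nat
  assumes "n \<ge> 1"
  shows "alpha12 \<theta> n * p12 \<theta> (n + 2) + beta12 \<theta> n * p12 \<theta> (n + 1) + gamma12 \<theta> n * p12 \<theta> n = 0"
    and "alpha12 \<theta> n * q12 \<theta> (n + 2) + beta12 \<theta> n * q12 \<theta> (n + 1) + gamma12 \<theta> n * q12 \<theta> n = 0"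
proof -
  define cut where "cut f m k = (if k \<le> m then f m k else 0)" for f :: "nat \<Rightarrow> nat \<Rightarrow> real" and m k
  define L where "L f = (real n + 1)\<^sup>2 *
    (alpha12 \<theta> n * f (n + 2) + beta12 \<theta> n * f (n + 1) + gamma12 \<theta> n * f n)" for f :: "nat \<Rightarrow> real"
  define A where "A k = L (\<lambda>m. cut (a12 \<theta>) m k)" for k
  define B where "B k = L (\<lambda>m. cut (b12 \<theta>) m k)" for k
  have L_sum: "(\<Sum>k\<in>K. L (\<lambda>m. f m k)) = L (\<lambda>m. \<Sum>k\<in>K. f m k)" for f and K :: "nat set"
    by (simp add: L_def sum.distrib flip: sum_distrib_left)
  have L_scale: "L (\<lambda>m. f m * s) = L f * s" for f s
    by (simp add: L_def algebra_simps)
  have L_diff: "L (\<lambda>m. f m - g m) = L f - L g" for f g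
    by (simp add: L_def algebra_simps)
  have L_cong: "L f = L g" if "\<And>m. n \<le> m \<Longrightarrow> m \<le> n + 2 \<Longrightarrow> f m = g m" for f g
    using that by (simp add: L_def)
  have cut_sum: "(\<Sum>k<n + 3. cut f m k * h k) = (\<Sum>k\<le>m. f m k * h k)" if "m \<le> n + 2" for f h m
    using that by (intro sum.mono_neutral_cong_right) (auto simp: cut_def)
  obtain C c d where S: "\<And>t. (\<forall>k<n + 2. t \<noteq> - (real k + 1)) \<Longrightarrow>
      antidifference12 \<theta> n t = C + double_poles c d (n + 2) t"
    using antidifference12_expansion[of n \<theta>] by blast
  have telescope: "double_poles A B (n + 3) t = antidifference12 \<theta> n (t + 1) - antidifference12 \<theta> n t"
    if t: "\<forall>k<n + 3. t \<noteq> - (real k + 1)" for t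
  proof -
    have "double_poles A B (n + 3) t = L (\<lambda>m. double_poles (cut (a12 \<theta>) m) (cut (b12 \<theta>) m) (n + 3) t)"
      unfolding L_sum[symmetric] divide_inverse L_diff L_scale A_def B_def ..
    also have "\<dots> = L (\<lambda>m. R12 \<theta> m t)"
    proof (rule L_cong)
      fix m assume m: "n \<le> m" "m \<le> n + 2"
      have "double_poles (cut (a12 \<theta>) m) (cut (b12 \<theta>) m) (n + 3) t
          = double_poles (a12 \<theta> m) (b12 \<theta> m) (Suc m) t"
        unfolding sum_subtractf divide_inverse cut_sum[OF m(2)] lessThan_Suc_atMost ..
      also have "\<dots> = R12 \<theta> m t"
        using m t assms by (intro R12_expansion[symmetric]) auto
      finally show "double_poles (cut (a12 \<theta>) m) (cut (b12 \<theta>) m) (n + 3) t = R12 \<theta> m t" .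
    qed
    also have "\<dots> = antidifference12 \<theta> n (t + 1) - antidifference12 \<theta> n t"
      unfolding L_def by (rule R12_telescopes[OF assms t])
    finally show ?thesis .
  qed
  have Suc: "n + 3 = Suc (n + 2)" by simp
  note zero = telescoping_annihilates[OF S telescope[unfolded Suc] antidifference12_flat[OF assms],
      folded Suc]
  have q: "q12 \<theta> m = 2 * (\<Sum>k<n + 3. cut (b12 \<theta>) m k)" if "m \<le> n + 2" for m
    using cut_sum[OF that, of "b12 \<theta>" "\<lambda>_. 1"] by (simp add: q12_def atLeast0AtMost)
  have p: "p12 \<theta> m = 2 * (\<Sum>k<n + 3. cut (b12 \<theta>) m k * gen_harm 3 k)
      - (\<Sum>k<n + 3. cut (a12 \<theta>) m k * gen_harm 2 k)" if "m \<le> n + 2" for m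
  proof -
    have "(\<Sum>k=1..m. f k * gen_harm r k) = (\<Sum>k\<le>m. f k * gen_harm r k)" for f r
      by (intro sum.mono_neutral_left) (auto simp: gen_harm_def not_le)
    then show ?thesis
      by (simp add: p12_def cut_sum[OF that])
  qed
  have "L (q12 \<theta>) = 2 * (\<Sum>k<n + 3. B k)"
    unfolding B_def L_sum by (simp add: L_def q algebra_simps)
  moreover have "L (p12 \<theta>) = 2 * (\<Sum>k<n + 3. B k * gen_harm 3 k) - (\<Sum>k<n + 3. A k * gen_harm 2 k)"
    unfolding A_def B_def L_scale[symmetric] L_sum by (simp add: L_def p algebra_simps)
  ultimately have "L (q12 \<theta>) = 0" "L (p12 \<theta>) = 0"
    using zero by simp_all
  moreover have "real n + 1 \<noteq> 0" by linarith
  ultimately show "alpha12 \<theta> n * p12 \<theta> (n + 2) + beta12 \<theta> n * p12 \<theta> (n + 1) + gamma12 \<theta> n * p12 \<theta> n = 0"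
    and "alpha12 \<theta> n * q12 \<theta> (n + 2) + beta12 \<theta> n * q12 \<theta> (n + 1) + gamma12 \<theta> n * q12 \<theta> n = 0"
    unfolding L_def by simp_all
qed

theorem theorem4p2:
  fixes \<theta> :: nat
  assumes "\<theta> \<ge> 1" and "\<theta> \<noteq> 1"
  shows "satisfies_recurrence12 \<theta> (p12 \<theta>) \<and> satisfies_recurrence12 \<theta> (q12 \<theta>) \<and> satisfies_recurrence12 \<theta> (r12 \<theta>)"
proof -
  have "alpha12 \<theta> n * r12 \<theta> (n + 2) + beta12 \<theta> n * r12 \<theta> (n + 1) + gamma12 \<theta> n * r12 \<theta> n
      = (alpha12 \<theta> n * q12 \<theta> (n + 2) + beta12 \<theta> n * q12 \<theta> (n + 1) + gamma12 \<theta> n * q12 \<theta> n) * zeta_real 3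
        - (alpha12 \<theta> n * p12 \<theta> (n + 2) + beta12 \<theta> n * p12 \<theta> (n + 1) + gamma12 \<theta> n * p12 \<theta> n)" for n :: nat
    by (simp add: r12_def algebra_simps)
  then show ?thesis
    using p12_q12_recurrence by (simp add: satisfies_recurrence12_def)
qed

end
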